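(* Let $X$ be a Hausdorff locally convex topological vector space, let $K$ be a nonempty convex compact subset of $X$, let $D\subseteq K$ be a self segment-dense set in $K$, and let $F:K\times K\rightrightarrows\mathbb{R}$ be a set-valued map satisfying: (i) for all $y\in D$, the map $x\mapsto F(x,y)$ is lower semicontinuous on $K$; (ii) for all $x\in K$, the map $y\mapsto F(x,y)$ is lower semicontinuous on $K\setminus D$; (iii) for all $x\in D$, the map $y\mapsto F(x,y)$ is convex on $D$; (iv) for all $x\in D$, $F(x,x)\ge 0$. Then there exists $x_0\in K$ such that $F(x_0,y)\ge 0$ for all $y\in K$.
   Context: Self segment-dense: for $U\subseteq V\subseteq X$ with $V$ convex, $U$ is self segment-dense in $V$ if $U$ is dense in $V$ (i.e. $V\subseteq\operatorname{cl}(U)$) and for all $x,y\in U$ the set $[x,y]\cap U$ is dense in the closed segment $[x,y]=\{x+t(y-x):t\in[0,1]\}$. Notation: $F(x,y)\ge 0$ means $u\ge 0$ for all $u\in F(x,y)$. Lower semicontinuity: a set-valued map $T:A\rightrightarrows\mathbb{R}$ on a topological space $A$ (here $A=K$ with the subspace topology), with domain $D(T)=\{x\in A:T(x)\ne\emptyset\}$, is lower semicontinuous at $x\in D(T)$ if for every open $N\subseteq\mathbb{R}$ with $T(x)\cap N\neq\emptyset$ there is a neighborhood $M$ of $x$ in $A$ such that $T(y)\cap N\ne\emptyset$ for every $y\in M\cap D(T)$. It is lower semicontinuous on $S\subseteq A$ if it is lower semicontinuous at every point of $S$ (so in particular $S\subseteq D(T)$); here $T$ is still regarded as a map on all of $A$.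 Convexity on a not necessarily convex set: $T$ is convex on $D$ if for all $x_1,\dots,x_n\in D$ and $\lambda_i\ge0$ with $\sum_{i=1}^n\lambda_i=1$ and $\sum_{i=1}^n\lambda_ix_i\in D$ one has $\sum_{i=1}^n\lambda_iT(x_i)\subseteq T\left(\sum_{i=1}^n\lambda_ix_i\right)$ (Minkowski sum). *)

theory Defs
  imports "HOL-Analysis.Analysis"
begin

class topological_real_vector = real_vector + topological_ab_group_add +
  assumes tendsto_scaleR_Pair:
    "LIM p (nhds (c::real) \<times>\<^sub>F nhds x). fst p *\<^sub>R snd p :> nhds (c *\<^sub>R x)"

text \<open>
  The origin has a base of convex neighbourhoods \<open>W\<close>, which are not required to be open.  Convexity
  is written out because \<^const>\<open>convex\<close> is not available inside a class specification.
\<close>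

class locally_convex_space = topological_real_vector +
  assumes convex_nhds_zero:
    "open U \<Longrightarrow> 0 \<in> U \<Longrightarrow> \<exists>V W. open V \<and> 0 \<in> V \<and> V \<subseteq> W \<and> W \<subseteq> U \<and>
       (\<forall>x\<in>W. \<forall>y\<in>W. \<forall>u\<ge>0. \<forall>v\<ge>0. u + v = 1 \<longrightarrow> u *\<^sub>R x + v *\<^sub>R y \<in> W)"

lemma convex_nhds_zero':
  fixes U :: "'a::locally_convex_space set"
  assumes "open U" "0 \<in> U"
  shows "\<exists>V W. open V \<and> 0 \<in> V \<and> V \<subseteq> W \<and> W \<subseteq> U \<and> convex W"
  using convex_nhds_zero[OF assms] unfolding convex_def by blast

instance real_normed_vector \<subseteq> locally_convex_space
proof
  fix c :: real and x :: 'a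
  show "LIM p (nhds c \<times>\<^sub>F nhds x). fst p *\<^sub>R snd p :> nhds (c *\<^sub>R x)"
    by (intro tendsto_scaleR filterlim_fst filterlim_snd)
next
  fix U :: "'a set"
  assume "open U" "0 \<in> U"
  then obtain e where "e > 0" "ball 0 e \<subseteq> U"
    using openE by blast
  then show "\<exists>V W. open V \<and> 0 \<in> V \<and> V \<subseteq> W \<and> W \<subseteq> U \<and>
       (\<forall>x\<in>W. \<forall>y\<in>W. \<forall>u\<ge>0. \<forall>v\<ge>0. u + v = 1 \<longrightarrow> u *\<^sub>R x + v *\<^sub>R y \<in> W)"
    unfolding convex_def[symmetric] by (intro exI[of _ "ball 0 e"]) (auto intro: convex_ball)
qed

definition self_segment_dense ::
    "'a::{real_vector, topological_space} set \<Rightarrow> 'a set \<Rightarrow> bool" where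
  "self_segment_dense U V \<longleftrightarrow> U \<subseteq> V \<and> convex V \<and> V \<subseteq> closure U \<and>
     (\<forall>x\<in>U. \<forall>y\<in>U. closed_segment x y \<subseteq> closure (closed_segment x y \<inter> U))"

text \<open>
  A set-valued map on \<open>A\<close> is given by a total function \<open>T\<close> whose values outside \<open>A\<close> are ignored.
\<close>

definition sv_domain :: "'a set \<Rightarrow> ('a \<Rightarrow> 'b set) \<Rightarrow> 'a set" where
  "sv_domain A T = {x \<in> A. T x \<noteq> {}}"

definition lsc_at ::
    "'a::topological_space set \<Rightarrow> ('a \<Rightarrow> 'b::topological_space set) \<Rightarrow> 'a \<Rightarrow> bool" where
  "lsc_at A T x \<longleftrightarrow> x \<in> sv_domain A T \<and>
     (\<forall>N. open N \<and> T x \<inter> N \<noteq> {} \<longrightarrow>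
        (\<exists>M. openin (top_of_set A) M \<and> x \<in> M \<and>
             (\<forall>y \<in> M \<inter> sv_domain A T. T y \<inter> N \<noteq> {})))"

definition lsc_on ::
    "'a::topological_space set \<Rightarrow> ('a \<Rightarrow> 'b::topological_space set) \<Rightarrow> 'a set \<Rightarrow> bool" where
  "lsc_on A T S \<longleftrightarrow> (\<forall>x\<in>S. lsc_at A T x)"

text \<open>The second sum is the Minkowski sum of sets.\<close>

definition sv_convex_on ::
    "'a::real_vector set \<Rightarrow> ('a \<Rightarrow> 'b::real_vector set) \<Rightarrow> bool" where
  "sv_convex_on D T \<longleftrightarrow>
     (\<forall>(n::nat) (x :: nat \<Rightarrow> 'a) (l :: nat \<Rightarrow> real).
        (\<forall>i\<in>{1..n}. x i \<in> D \<and> 0 \<le> l i) \<and> (\<Sum>i=1..n. l i) = 1 \<and> (\<Sum>i=1..n. l i *\<^sub>R x i) \<in> D \<longrightarrow>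
        (\<Sum>i=1..n. (*\<^sub>R) (l i) ` T (x i)) \<subseteq> T (\<Sum>i=1..n. l i *\<^sub>R x i))"

definition sv_nonneg :: "real set \<Rightarrow> bool" where
  "sv_nonneg A \<longleftrightarrow> (\<forall>u\<in>A. 0 \<le> u)"

end

theory Submission
  imports Defs
begin

text \<open>
  For \<open>y \<in> D\<close> the set \<open>G y\<close> of all \<open>x \<in> K\<close> with \<open>F x y \<ge> 0\<close> is closed by (i).  For finite
  \<open>Z \<subseteq> D\<close>, (iii) and (iv) put every point of \<open>convex hull Z \<inter> D\<close> into some \<open>G y\<close> with \<open>y \<in> Z\<close>;
  since self segment-density makes \<open>D\<close> dense in \<open>convex hull Z\<close>, the closed sets \<open>G y\<close> cover the
  whole hull.  The KKM principle and compactness give a point \<open>x0\<close> common to all \<open>G y\<close>, \<open>y \<in> D\<close>,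
  and a negative value of \<open>F x0\<close> at a point outside \<open>D\<close> would by (ii) persist at nearby points
  of \<open>D\<close>.

  KKM needs Brouwer's theorem in every finite dimension, so the dimension cannot be a type:
  points are functions \<open>nat \<Rightarrow> real\<close> vanishing from \<open>n\<close> on.
\<close>

section \<open>Brouwer's theorem for the cube, from Kuhn's combinatorial lemma\<close>

definition unit_cube :: "nat \<Rightarrow> (nat \<Rightarrow> real) set" where
  "unit_cube n = (\<Pi>\<^sub>E i\<in>UNIV. if i < n then {0..1} else {0})"

lemma mem_unit_cube:
  "x \<in> unit_cube n \<longleftrightarrow> (\<forall>i<n. 0 \<le> x i \<and> x i \<le> 1) \<and> (\<forall>i\<ge>n. x i = 0)"
proof -
  have "x \<in> unit_cube n \<longleftrightarrow> (\<forall>i. if i < n then 0 \<le> x i \<and> x i \<le> 1 else x i = 0)"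
    unfolding unit_cube_def PiE_iff by (simp add: if_distrib [of "\<lambda>A. _ \<in> A"])
  then show ?thesis
    by (meson not_le)
qed

text \<open>Tychonoff's theorem. For its sake the cube is a product over all of \<open>nat\<close>,
  with factor \<open>{0}\<close> from \<open>n\<close> on: the product topology is then the topology
  of the function type.\<close>

lemma compact_unit_cube: "compact (unit_cube n)"
proof -
  have "compactin (product_topology (\<lambda>i. euclidean) UNIV) (unit_cube n)"
    unfolding unit_cube_def by (subst compactin_PiE) auto
  then show ?thesis
    by (simp add: euclidean_product_topology)
qed

lemma tendsto_fun_iff:
  fixes X :: "'c \<Rightarrow> 'i \<Rightarrow> 'b::topological_space"
  shows "(X \<longlongrightarrow> z) G \<longleftrightarrow> (\<forall>i. ((\<lambda>k. X k i) \<longlongrightarrow> z i) G)"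
proof -
  have "(X \<longlongrightarrow> z) G \<longleftrightarrow> limitin (product_topology (\<lambda>i. euclidean) UNIV) X z G"
    by (simp add: euclidean_product_topology)
  then show ?thesis
    by (simp add: limitin_componentwise)
qed

text \<open>Kuhn's lemma on the grid of mesh \<open>1 / p\<close>. The witnesses \<open>a\<close>
  and \<open>b\<close> may change with the coordinate \<open>i\<close>, but all lie close to one
  \<open>q\<close>, so in the limit of fine meshes they squeeze \<open>f\<close> to the
  identity.\<close>

lemma approximate_fixed_point_unit_cube:
  fixes f :: "(nat \<Rightarrow> real) \<Rightarrow> nat \<Rightarrow> real"
  assumes f: "f \<in> unit_cube n \<rightarrow> unit_cube n" and "p > 0"
  shows "\<exists>q\<in>unit_cube n. \<forall>i<n. \<exists>a\<in>unit_cube n. \<exists>b\<in>unit_cube n.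
    (\<forall>j. \<bar>a j - q j\<bar> \<le> 1 / real p) \<and> (\<forall>j. \<bar>b j - q j\<bar> \<le> 1 / real p) \<and> f a i \<le> a i \<and> b i \<le> f b i"
proof -
  define e :: "(nat \<Rightarrow> nat) \<Rightarrow> nat \<Rightarrow> real" where "e = (\<lambda>m j. if j < n then m j / p else 0)"
  \<comment> \<open>Label 1 marks coordinates that \<open>f\<close> does not increase, label 0 those
    that it does not decrease. On the faces \<open>m i = 0\<close> and \<open>m i = p\<close> the
    label is forced as Kuhn's lemma demands; this agrees with the marking because \<open>f\<close>
    stays in the cube.\<close>
  define label :: "(nat \<Rightarrow> nat) \<Rightarrow> nat \<Rightarrow> nat" where
    "label = (\<lambda>m i. if m i = p \<or> m i \<noteq> 0 \<and> f (e m) i < e m i then 1 else 0)"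
  have bin: "label m i = 0 \<or> label m i = 1" for m i
    by (simp add: label_def)
  have e: "e m \<in> unit_cube n" if "\<And>j. j < n \<Longrightarrow> m j \<le> p" for m
    using that \<open>p > 0\<close> by (auto simp: mem_unit_cube e_def)
  have fe: "f (e m) \<in> unit_cube n" if "\<And>j. j < n \<Longrightarrow> m j \<le> p" for m
    using f e[of m] that by blast
  have lab1: "f (e m) i \<le> e m i" if "\<And>j. j < n \<Longrightarrow> m j \<le> p" "label m i = 1" "i < n" for m i
    using fe[of m] that \<open>p > 0\<close> by (auto simp: label_def e_def mem_unit_cube split: if_splits)
  have lab0: "e m i \<le> f (e m) i" if "\<And>j. j < n \<Longrightarrow> m j \<le> p" "label m i = 0" "i < n" for m i
    using fe[of m] that \<open>p > 0\<close> by (auto simp: label_def e_def mem_unit_cube split: if_splits)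
  obtain q where q: "\<forall>i<n. q i < p" and qrs: "\<forall>i<n. \<exists>r s. (\<forall>j<n. q j \<le> r j \<and> r j \<le> q j + 1) \<and>
      (\<forall>j<n. q j \<le> s j \<and> s j \<le> q j + 1) \<and> label r i \<noteq> label s i"
    by (rule kuhn_lemma[of p n label]) (use \<open>p > 0\<close> in \<open>auto simp: label_def\<close>)
  have close: "\<bar>e m j - e q j\<bar> \<le> 1 / real p" if "\<forall>j<n. q j \<le> m j \<and> m j \<le> q j + 1" for m j
  proof (cases "j < n")
    case True
    then have "real (q j) \<le> m j" "real (m j) \<le> q j + 1"
      using that by (auto simp: of_nat_le_iff simp flip: of_nat_Suc)
    then have "0 \<le> (real (m j) - q j) / p" "(real (m j) - q j) / p \<le> 1 / p"
      by (auto intro: divide_right_mono)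
    then show ?thesis
      using True by (simp add: e_def diff_divide_distrib)
  qed (simp add: e_def)
  \<comment> \<open>Since \<open>q j < p\<close> is strict, the far corners of the cell at
    \<open>q\<close> are still grid points.\<close>
  have le: "m j \<le> p" if "\<forall>j<n. q j \<le> m j \<and> m j \<le> q j + 1" "j < n" for m j
    using that q by (metis Suc_eq_plus1 Suc_leI le_trans)
  show ?thesis
  proof (rule bexI[of _ "e q"], intro allI impI)
    fix i assume i: "i < n"
    obtain r s where rs: "\<forall>j<n. q j \<le> r j \<and> r j \<le> q j + 1" "\<forall>j<n. q j \<le> s j \<and> s j \<le> q j + 1"
      "label r i \<noteq> label s i"
      using qrs i by blast
    have "\<exists>r s. (\<forall>j<n. q j \<le> r j \<and> r j \<le> q j + 1) \<and> (\<forall>j<n. q j \<le> s j \<and> s j \<le> q j + 1) \<and>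
       label r i = 1 \<and> label s i = 0"
    proof (cases "label r i = 1")
      case True
      then have "label s i = 0"
        using rs(3) bin by metis
      then show ?thesis using True rs by blast
    next
      case False
      then have "label s i = 1" "label r i = 0"
        using rs(3) bin by metis+
      then show ?thesis using rs by blast
    qed
    then obtain r s where r: "\<forall>j<n. q j \<le> r j \<and> r j \<le> q j + 1" "label r i = 1"
      and s: "\<forall>j<n. q j \<le> s j \<and> s j \<le> q j + 1" "label s i = 0"
      by blast
    show "\<exists>a\<in>unit_cube n. \<exists>b\<in>unit_cube n.
      (\<forall>j. \<bar>a j - e q j\<bar> \<le> 1 / real p) \<and> (\<forall>j. \<bar>b j - e q j\<bar> \<le> 1 / real p) \<and> f a i \<le> a i \<and> b i \<le> f b i"
      using e[of r] e[of s] close[OF r(1)] close[OF s(1)] lab1[of r i] lab0[of s i]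
        le[OF r(1)] le[OF s(1)] r(2) s(2) i
      by blast
  qed (rule e, use q in \<open>simp add: less_imp_le\<close>)
qed

text \<open>Approximate fixed points for meshes tending to 0 accumulate at some \<open>z\<close> by
  compactness. The witnesses of both inequalities converge to the same \<open>z\<close>, and
  continuity gives \<open>f z i \<le> z i\<close> and \<open>z i \<le> f z i\<close>.\<close>

lemma Brouwer_unit_cube:
  fixes f :: "(nat \<Rightarrow> real) \<Rightarrow> nat \<Rightarrow> real"
  assumes cont: "continuous_on (unit_cube n) f" and f: "f \<in> unit_cube n \<rightarrow> unit_cube n"
  shows "\<exists>z\<in>unit_cube n. f z = z"
proof -
  have "\<forall>p. \<exists>q\<in>unit_cube n. \<forall>i<n. \<exists>a\<in>unit_cube n. \<exists>b\<in>unit_cube n.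
    (\<forall>j. \<bar>a j - q j\<bar> \<le> 1 / real (Suc p)) \<and> (\<forall>j. \<bar>b j - q j\<bar> \<le> 1 / real (Suc p)) \<and>
    f a i \<le> a i \<and> b i \<le> f b i"
    using approximate_fixed_point_unit_cube[OF f] by blast
  then obtain q where q: "\<And>p. q p \<in> unit_cube n" and ab: "\<forall>p. \<forall>i<n. \<exists>a\<in>unit_cube n. \<exists>b\<in>unit_cube n.
    (\<forall>j. \<bar>a j - q p j\<bar> \<le> 1 / real (Suc p)) \<and> (\<forall>j. \<bar>b j - q p j\<bar> \<le> 1 / real (Suc p)) \<and>
    f a i \<le> a i \<and> b i \<le> f b i"
    by metis
  \<comment> \<open>The index set is countable, so the function type is a metric space and
    compactness is sequential.\<close>
  obtain z \<rho> where z: "z \<in> unit_cube n" and \<rho>: "strict_mono (\<rho> :: nat \<Rightarrow> nat)" and lim: "(q \<circ> \<rho>) \<longlonglongrightarrow> z"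
    using compact_unit_cube[of n] q unfolding compact_eq_seq_compact_metric seq_compact_def by blast
  have inv: "(\<lambda>k. 1 / real (Suc (\<rho> k))) \<longlonglongrightarrow> 0"
    using LIMSEQ_subseq_LIMSEQ[OF LIMSEQ_inverse_real_of_nat \<rho>]
    by (simp add: o_def inverse_eq_divide)
  have near: "a \<longlonglongrightarrow> z" if "\<And>k j. \<bar>a k j - q (\<rho> k) j\<bar> \<le> 1 / real (Suc (\<rho> k))" for a
    unfolding tendsto_fun_iff
  proof
    fix j
    have "(\<lambda>k. a k j - q (\<rho> k) j) \<longlonglongrightarrow> 0"
      by (rule Lim_null_comparison[OF _ inv]) (use that in auto)
    moreover have "(\<lambda>k. q (\<rho> k) j) \<longlonglongrightarrow> z j"
      using lim by (simp add: tendsto_fun_iff)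
    ultimately show "(\<lambda>k. a k j) \<longlonglongrightarrow> z j"
      using tendsto_add by fastforce
  qed
  have fz: "(\<lambda>k. f (a k) i) \<longlonglongrightarrow> f z i" if "a \<longlonglongrightarrow> z" "\<And>k. a k \<in> unit_cube n" for a i
    using continuous_on_tendsto_compose[OF cont that(1) z] that(2) by (simp add: tendsto_fun_iff)
  have "f z i = z i" for i
  proof (cases "i < n")
    case True
    have "\<forall>k. \<exists>a b. a \<in> unit_cube n \<and> b \<in> unit_cube n \<and>
      (\<forall>j. \<bar>a j - q (\<rho> k) j\<bar> \<le> 1 / real (Suc (\<rho> k))) \<and> (\<forall>j. \<bar>b j - q (\<rho> k) j\<bar> \<le> 1 / real (Suc (\<rho> k))) \<and>
      f a i \<le> a i \<and> b i \<le> f b i"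
      using ab True by blast
    then obtain a b where a: "\<And>k. a k \<in> unit_cube n" "\<And>k j. \<bar>a k j - q (\<rho> k) j\<bar> \<le> 1 / real (Suc (\<rho> k))"
      "\<And>k. f (a k) i \<le> a k i"
      and b: "\<And>k. b k \<in> unit_cube n" "\<And>k j. \<bar>b k j - q (\<rho> k) j\<bar> \<le> 1 / real (Suc (\<rho> k))"
      "\<And>k. b k i \<le> f (b k) i"
      by metis
    have az: "a \<longlonglongrightarrow> z" and bz: "b \<longlonglongrightarrow> z"
      using near a b by auto
    have "f z i \<le> z i"
      using LIMSEQ_le[OF fz[OF az a(1), of i], of "\<lambda>k. a k i"] az a(3) by (auto simp: tendsto_fun_iff)
    moreover have "z i \<le> f z i"
      using LIMSEQ_le[OF _ fz[OF bz b(1), of i], of "\<lambda>k. b k i"] bz b(3) by (auto simp: tendsto_fun_iff)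
    ultimately show ?thesis by simp
  next
    case False
    then show ?thesis
      using z f by (metis Pi_mem leI mem_unit_cube)
  qed
  then show ?thesis
    using z by blast
qed

section \<open>Brouwer's theorem and the KKM principle on the standard simplex\<close>

definition std_simplex :: "nat \<Rightarrow> (nat \<Rightarrow> real) set" where
  "std_simplex n = {t. (\<forall>i<n. 0 \<le> t i) \<and> (\<forall>i\<ge>n. t i = 0) \<and> (\<Sum>i<n. t i) = 1}"

lemma std_simplex_subset_unit_cube: "std_simplex n \<subseteq> unit_cube n"
proof
  fix t assume t: "t \<in> std_simplex n"
  have "t i \<le> 1" if "i < n" for i
    using t member_le_sum[of i "{..<n}" t] that by (auto simp: std_simplex_def)
  then show "t \<in> unit_cube n"
    using t by (auto simp: std_simplex_def mem_unit_cube)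
qed

lemma continuous_on_coord [continuous_intros]: "continuous_on S (\<lambda>x. x i)"
  by (rule continuous_on_product_then_coordinatewise[OF continuous_on_id])

text \<open>A coordinate sum below 1 is raised by spreading the deficit evenly; a sum above 1 is
  divided out. Neither correction acts at sum 1, and \<open>max\<close> keeps the formula
  continuous.\<close>

definition simplex_retraction :: "nat \<Rightarrow> (nat \<Rightarrow> real) \<Rightarrow> nat \<Rightarrow> real" where
  "simplex_retraction n s i =
     (if i < n then (s i + max 0 (1 - (\<Sum>j<n. s j)) / n) / max 1 (\<Sum>j<n. s j) else 0)"

lemma continuous_simplex_retraction: "continuous_on S (simplex_retraction n)"
proof (rule continuous_on_coordinatewise_then_product)
  fix i
  show "continuous_on S (\<lambda>s. simplex_retraction n s i)"
    unfolding simplex_retraction_def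
    by (cases "i < n") (auto intro!: continuous_intros)
qed

lemma simplex_retraction_mem:
  assumes "n > 0" "s \<in> unit_cube n"
  shows "simplex_retraction n s \<in> std_simplex n"
proof -
  have "(\<Sum>i<n. simplex_retraction n s i)
    = ((\<Sum>i<n. s i) + max 0 (1 - (\<Sum>j<n. s j))) / max 1 (\<Sum>j<n. s j)"
    using \<open>n > 0\<close> by (simp add: simplex_retraction_def sum.distrib flip: sum_divide_distrib)
  also have "\<dots> = 1"
    by (simp add: max_def)
  finally show ?thesis
    using assms by (auto simp: std_simplex_def simplex_retraction_def mem_unit_cube)
qed

lemma simplex_retraction_id: "s \<in> std_simplex n \<Longrightarrow> simplex_retraction n s = s"
  by (rule ext) (simp add: std_simplex_def simplex_retraction_def)

text \<open>A fixed point of \<open>f \<circ> simplex_retraction n\<close> on the cube is a value of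
  \<open>f\<close>, hence lies in the simplex, where the retraction is the identity.\<close>

lemma Brouwer_std_simplex:
  fixes f :: "(nat \<Rightarrow> real) \<Rightarrow> nat \<Rightarrow> real"
  assumes "n > 0" and cont: "continuous_on (std_simplex n) f" and f: "f \<in> std_simplex n \<rightarrow> std_simplex n"
  shows "\<exists>z\<in>std_simplex n. f z = z"
proof -
  have r: "simplex_retraction n ` unit_cube n \<subseteq> std_simplex n"
    using simplex_retraction_mem[OF \<open>n > 0\<close>] by blast
  have "continuous_on (unit_cube n) (f \<circ> simplex_retraction n)"
    by (intro continuous_on_compose continuous_simplex_retraction continuous_on_subset[OF cont r])
  moreover have "f \<circ> simplex_retraction n \<in> unit_cube n \<rightarrow> unit_cube n"
    using f r std_simplex_subset_unit_cube by fastforce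
  ultimately obtain z where z: "z \<in> unit_cube n" "f (simplex_retraction n z) = z"
    using Brouwer_unit_cube by fastforce
  then have "z \<in> std_simplex n"
    using f r by (metis Pi_mem image_subset_iff)
  then show ?thesis
    using z simplex_retraction_id by metis
qed

text \<open>The condition \<open>0 < t i\<close> in the cover is the KKM face condition. Without a
  common point the distances to the sets \<open>A i\<close> never vanish together, so normalising
  them gives a continuous self-map of the simplex. At its fixed point, the \<open>i\<close> supplied
  by the cover has \<open>t i\<close> both positive and 0.\<close>

lemma KKM_std_simplex:
  fixes A :: "nat \<Rightarrow> (nat \<Rightarrow> real) set"
  assumes "n > 0" and closed: "\<And>i. i < n \<Longrightarrow> closed (A i)"
    and cover: "\<And>t. t \<in> std_simplex n \<Longrightarrow> \<exists>i<n. 0 < t i \<and> t \<in> A i"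
  shows "\<exists>t\<in>std_simplex n. \<forall>i<n. t \<in> A i"
proof (rule ccontr)
  assume contra: "\<not> ?thesis"
  \<comment> \<open>\<open>infdist\<close> to the empty set is 0 by convention, so distance 0 means
    membership only for nonempty sets. The \<open>i\<close>-th vertex has no other positive
    coordinate, so the cover puts it into \<open>A i\<close>.\<close>
  have nonempty: "A i \<noteq> {}" if "i < n" for i
  proof -
    have "(\<lambda>j. if j = i then 1 else 0) \<in> std_simplex n"
      using that by (auto simp: std_simplex_def)
    from cover[OF this] show ?thesis
      by (auto split: if_splits)
  qed
  define d where "d = (\<lambda>t i. infdist t (A i))"
  have d0: "d t i = 0 \<longleftrightarrow> t \<in> A i" if "i < n" for t i
    using in_closed_iff_infdist_zero[OF closed nonempty] that by (simp add: d_def)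
  have d_nonneg: "0 \<le> d t i" for t i
    by (simp add: d_def infdist_nonneg)
  have pos: "0 < (\<Sum>i<n. d t i)" if t: "t \<in> std_simplex n" for t
  proof -
    obtain i where "i < n" "t \<notin> A i"
      using contra t by blast
    then have "0 < d t i"
      using d0 d_nonneg by (simp add: less_le)
    then show ?thesis
      using \<open>i < n\<close> d_nonneg by (intro sum_pos2[of _ i]) auto
  qed
  define f where "f = (\<lambda>t i. if i < n then d t i / (\<Sum>j<n. d t j) else 0)"
  have "continuous_on (std_simplex n) f"
  proof (rule continuous_on_coordinatewise_then_product)
    fix i
    have "\<forall>t\<in>std_simplex n. (\<Sum>j<n. d t j) \<noteq> 0"
      using pos by (metis less_irrefl)
    moreover have "continuous_on (std_simplex n) (\<lambda>t. d t j)" for j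
      unfolding d_def by (rule continuous_on_infdist[OF continuous_on_id])
    ultimately have "continuous_on (std_simplex n) (\<lambda>t. d t i / (\<Sum>j<n. d t j))"
      by (intro continuous_on_divide continuous_on_sum)
    then show "continuous_on (std_simplex n) (\<lambda>t. f t i)"
      by (cases "i < n") (simp_all add: f_def)
  qed
  moreover have "f \<in> std_simplex n \<rightarrow> std_simplex n"
  proof
    fix t assume t: "t \<in> std_simplex n"
    have "(\<Sum>i<n. f t i) = 1"
      using pos[OF t] by (simp add: f_def flip: sum_divide_distrib)
    then show "f t \<in> std_simplex n"
      using d_nonneg by (simp add: std_simplex_def f_def sum_nonneg)
  qed
  ultimately obtain t where t: "t \<in> std_simplex n" "f t = t"
    using Brouwer_std_simplex[OF \<open>n > 0\<close>] by blast
  obtain i where i: "i < n" "0 < t i" "t \<in> A i"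
    using cover[OF t(1)] by blast
  then have "f t i = 0"
    using d0 by (simp add: f_def)
  then show False
    using t i by simp
qed

section \<open>The finite KKM principle and density in convex hulls, in a topological vector
  space\<close>

lemma tendsto_scaleR_tvs:
  fixes g :: "'c \<Rightarrow> 'a::topological_real_vector"
  assumes "(f \<longlongrightarrow> c) G" "(g \<longlongrightarrow> x) G"
  shows "((\<lambda>k. f k *\<^sub>R g k) \<longlongrightarrow> c *\<^sub>R x) G"
  using filterlim_compose[OF tendsto_scaleR_Pair filterlim_Pair[OF assms]] by simp

lemma continuous_on_scaleR_tvs:
  fixes g :: "'c::topological_space \<Rightarrow> 'a::topological_real_vector"
  assumes "continuous_on S f" "continuous_on S g"
  shows "continuous_on S (\<lambda>x. f x *\<^sub>R g x)"
  using assms unfolding continuous_on_def by (blast intro: tendsto_scaleR_tvs)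

text \<open>The sets \<open>G y\<close> are pulled back to the simplex along the barycentric map
  \<open>\<phi>\<close>, which is continuous.\<close>

lemma KKM_finite:
  fixes G :: "'a::topological_real_vector \<Rightarrow> 'a set"
  assumes "finite Y" "Y \<noteq> {}" and closed: "\<And>y. y \<in> Y \<Longrightarrow> closed (G y)"
    and cover: "\<And>Z. Z \<subseteq> Y \<Longrightarrow> convex hull Z \<subseteq> (\<Union>y\<in>Z. G y)"
  shows "\<exists>x\<in>convex hull Y. \<forall>y\<in>Y. x \<in> G y"
proof -
  define n where "n = card Y"
  obtain h where h: "bij_betw h {..<n} Y"
    using ex_bij_betw_nat_finite[OF \<open>finite Y\<close>] by (auto simp: n_def atLeast0LessThan)
  have hY: "h i \<in> Y" if "i < n" for i
    using h that by (auto simp: bij_betw_def)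
  have "n > 0"
    using assms by (simp add: n_def card_gt_0_iff)
  define \<phi> where "\<phi> = (\<lambda>t. \<Sum>i<n. t i *\<^sub>R h i)"
  have cont: "continuous_on UNIV \<phi>"
    unfolding \<phi>_def by (intro continuous_on_sum continuous_on_scaleR_tvs continuous_intros)
  have "\<exists>t\<in>std_simplex n. \<forall>i<n. t \<in> \<phi> -` G (h i)"
  proof (rule KKM_std_simplex[OF \<open>n > 0\<close>])
    show "closed (\<phi> -` G (h i))" if "i < n" for i
      using closed_vimage[OF closed cont] hY that by blast
    show "\<exists>i<n. 0 < t i \<and> t \<in> \<phi> -` G (h i)" if t: "t \<in> std_simplex n" for t
    proof -
      define I where "I = {i. i < n \<and> 0 < t i}"
      have I: "finite I" "I \<subseteq> {..<n}"
        by (auto simp: I_def)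
      have zero: "t i = 0" if "i \<in> {..<n} - I" for i
        using that t by (auto simp: I_def std_simplex_def less_le)
      have "(\<Sum>i\<in>I. t i) = 1"
        using sum.mono_neutral_right[OF finite_lessThan I(2), of t] zero t by (simp add: std_simplex_def)
      then have "(\<Sum>i\<in>I. t i *\<^sub>R h i) \<in> convex hull (h ` I)"
        using I by (intro convex_sum) (auto simp: I_def intro: hull_inc)
      moreover have "\<phi> t = (\<Sum>i\<in>I. t i *\<^sub>R h i)"
        unfolding \<phi>_def using zero by (intro sum.mono_neutral_right I) auto
      moreover have "convex hull (h ` I) \<subseteq> (\<Union>y\<in>h ` I. G y)"
        using I hY by (intro cover) auto
      ultimately obtain i where "i \<in> I" "\<phi> t \<in> G (h i)"
        by auto
      then show ?thesis
        by (auto simp: I_def)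
    qed
  qed
  then obtain t where t: "t \<in> std_simplex n" "\<And>i. i < n \<Longrightarrow> \<phi> t \<in> G (h i)"
    by auto
  have "\<phi> t \<in> convex hull Y"
    unfolding \<phi>_def using t(1) hY by (intro convex_sum) (auto simp: std_simplex_def intro: hull_inc)
  moreover have "\<phi> t \<in> G y" if "y \<in> Y" for y
    using h t(2) that by (auto simp: bij_betw_def)
  ultimately show ?thesis
    by blast
qed

text \<open>
  Induction on \<open>Y\<close>: a point of \<open>convex hull (insert a Z)\<close> is \<open>u *\<^sub>R a + v *\<^sub>R b\<close> with
  \<open>b\<close> approximable by points of \<open>convex hull Z \<inter> D\<close>, and each of those is joined to \<open>a\<close> by a
  segment in which \<open>D\<close> is dense.
\<close>

lemma self_segment_dense_convex_hull:
  fixes D :: "'a::topological_real_vector set"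
  assumes D: "self_segment_dense D K" and "finite Y" "Y \<subseteq> D"
  shows "convex hull Y \<subseteq> closure (convex hull Y \<inter> D)"
  using \<open>finite Y\<close> \<open>Y \<subseteq> D\<close>
proof (induction Y rule: finite_induct)
  case empty
  then show ?case by simp
next
  case (insert a Z)
  show ?case
  proof (cases "Z = {}")
    case True
    then show ?thesis
      using insert.prems closure_subset[of "{a}"] by simp
  next
    case False
    let ?H = "convex hull (insert a Z)"
    show ?thesis
    proof
      fix x assume "x \<in> ?H"
      then obtain u v b where uv: "0 \<le> u" "0 \<le> v" "u + v = 1" and b: "b \<in> convex hull Z"
        and x: "x = u *\<^sub>R a + v *\<^sub>R b"
        using convex_hull_insert[OF False] by blast
      \<comment> \<open>The point \<open>b\<close> itself need not lie in \<open>D\<close>: the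
        claim is shown for points of \<open>D\<close> in the hull of \<open>Z\<close> and carried to
        \<open>b\<close> by continuity of \<open>g\<close>.\<close>
      define g where "g = (\<lambda>w. u *\<^sub>R a + v *\<^sub>R w)"
      have "continuous_on (closure (convex hull Z \<inter> D)) g"
        unfolding g_def by (intro continuous_on_add continuous_on_scaleR_tvs continuous_intros)
      moreover have "g ` (convex hull Z \<inter> D) \<subseteq> closure (?H \<inter> D)"
      proof
        fix y assume "y \<in> g ` (convex hull Z \<inter> D)"
        then obtain w where w: "w \<in> convex hull Z" "w \<in> D" "y = u *\<^sub>R a + v *\<^sub>R w"
          by (auto simp: g_def)
        have "y \<in> closed_segment a w"
          using uv w by (auto simp: in_segment intro!: exI[of _ v])
        also have "\<dots> \<subseteq> closure (closed_segment a w \<inter> D)"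
          using D w insert.prems by (auto simp: self_segment_dense_def)
        also have "\<dots> \<subseteq> closure (?H \<inter> D)"
        proof (intro closure_mono Int_mono order_refl)
          have "w \<in> ?H"
            using w hull_mono[of Z "insert a Z"] by blast
          then show "closed_segment a w \<subseteq> ?H"
            by (intro closed_segment_subset) (auto intro: hull_inc)
        qed
        finally show "y \<in> closure (?H \<inter> D)" .
      qed
      ultimately have "g ` closure (convex hull Z \<inter> D) \<subseteq> closure (?H \<inter> D)"
        by (intro image_closure_subset) auto
      moreover have "b \<in> closure (convex hull Z \<inter> D)"
        using insert.IH insert.prems b by blast
      ultimately show "x \<in> closure (?H \<inter> D)"
        using x by (auto simp: g_def)
    qed
  qed
qed

section \<open>Consequences of semicontinuity and convexity, and the equilibrium point\<close>

lemma closed_sv_nonneg: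
  fixes K :: "'a::t2_space set" and T :: "'a \<Rightarrow> real set"
  assumes "compact K" and lsc: "lsc_on K T K"
  shows "closed {x\<in>K. sv_nonneg (T x)}"
proof -
  \<comment> \<open>Semicontinuity at a point includes a nonempty value there, so no point of
    \<open>K\<close> is lost to the domain.\<close>
  have dom: "sv_domain K T = K"
    using lsc by (auto simp: lsc_on_def lsc_at_def sv_domain_def)
  have "openin (top_of_set K) {x\<in>K. \<not> sv_nonneg (T x)}"
  proof (subst openin_subopen, safe)
    fix x assume x: "x \<in> K" "\<not> sv_nonneg (T x)"
    then have "T x \<inter> {..<0} \<noteq> {}"
      by (auto simp: sv_nonneg_def not_le)
    moreover have "lsc_at K T x"
      using lsc x(1) by (simp add: lsc_on_def)
    ultimately obtain M where M: "openin (top_of_set K) M" "x \<in> M"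
      "\<forall>y\<in>M \<inter> K. T y \<inter> {..<0} \<noteq> {}"
      unfolding lsc_at_def dom by (meson open_lessThan)
    have "\<not> sv_nonneg (T y)" if "y \<in> M \<inter> K" for y
    proof -
      obtain u where "u \<in> T y" "u < 0"
        using M(3) \<open>y \<in> M \<inter> K\<close> by blast
      then show ?thesis
        by (auto simp: sv_nonneg_def not_le)
    qed
    then have "M \<subseteq> {x\<in>K. \<not> sv_nonneg (T x)}"
      using openin_imp_subset[OF M(1)] by blast
    then show "\<exists>M. openin (top_of_set K) M \<and> x \<in> M \<and> M \<subseteq> {x\<in>K. \<not> sv_nonneg (T x)}"
      using M by blast
  qed
  then have "closedin (top_of_set K) (K - {x\<in>K. \<not> sv_nonneg (T x)})"
    by (auto intro: closedin_diff)
  moreover have "K - {x\<in>K. \<not> sv_nonneg (T x)} = {x\<in>K. sv_nonneg (T x)}"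
    by auto
  ultimately show ?thesis
    using closedin_closed_trans compact_imp_closed[OF \<open>compact K\<close>] by fastforce
qed

text \<open>Otherwise a negative element can be picked in each \<open>T y\<close>; convexity puts
  their weighted sum into \<open>T x\<close>, and it is negative because some weight is
  nonzero.\<close>

lemma sv_convex_on_nonneg_hull:
  fixes T :: "'a::real_vector \<Rightarrow> real set"
  assumes conv: "sv_convex_on D T" and "Y \<subseteq> D" and x: "x \<in> convex hull Y" "x \<in> D" "sv_nonneg (T x)"
  shows "\<exists>y\<in>Y. sv_nonneg (T y)"
proof (rule ccontr)
  assume "\<not> ?thesis"
  then have "\<forall>y\<in>Y. \<exists>u\<in>T y. u < 0"
    by (auto simp: sv_nonneg_def not_le)
  then obtain \<mu> where \<mu>: "\<And>y. y \<in> Y \<Longrightarrow> \<mu> y \<in> T y" "\<And>y. y \<in> Y \<Longrightarrow> \<mu> y < 0"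
    by metis
  obtain k l z where z: "\<forall>i\<in>{1::nat..k}. 0 \<le> l i \<and> z i \<in> Y" "sum l {1..k} = 1"
    "(\<Sum>i=1..k. l i *\<^sub>R z i) = x"
    using x(1) unfolding convex_hull_indexed by blast
  have "(\<Sum>i=1..k. l i *\<^sub>R \<mu> (z i)) \<in> (\<Sum>i=1..k. (*\<^sub>R) (l i) ` T (z i))"
    using z(1) \<mu>(1) by (auto simp: set_sum_alt intro!: exI[of _ "\<lambda>i. l i *\<^sub>R \<mu> (z i)"])
  moreover have "(\<Sum>i=1..k. (*\<^sub>R) (l i) ` T (z i)) \<subseteq> T x"
    using conv z \<open>Y \<subseteq> D\<close> x(2) unfolding sv_convex_on_def by blast
  ultimately have "0 \<le> (\<Sum>i=1..k. l i * \<mu> (z i))"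
    using x(3) by (auto simp: sv_nonneg_def)
  moreover obtain i where i: "i \<in> {1..k}" "l i \<noteq> 0"
    using z(2) by (metis sum.neutral zero_neq_one)
  have "(\<Sum>i=1..k. l i * \<mu> (z i)) < (\<Sum>i=1..k. 0)"
  proof (rule sum_strict_mono_ex1)
    show "\<forall>i\<in>{1..k}. l i * \<mu> (z i) \<le> 0"
      using z(1) \<mu>(2) by (meson less_imp_le mult_nonneg_nonpos)
    have "l i * \<mu> (z i) < 0"
      using z(1) \<mu>(2) i by (intro mult_pos_neg) (auto simp: less_le)
    then show "\<exists>i\<in>{1..k}. l i * \<mu> (z i) < 0"
      using i(1) by blast
  qed simp
  ultimately show False by simp
qed

theorem theorem3p1:
  fixes K D :: "'a::{locally_convex_space, t2_space} set"
    and F :: "'a \<Rightarrow> 'a \<Rightarrow> real set"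
  assumes "K \<noteq> {}" and "convex K" and "compact K"
    and "D \<subseteq> K" and "self_segment_dense D K"
    and "\<And>y. y \<in> D \<Longrightarrow> lsc_on K (\<lambda>x. F x y) K"
    and "\<And>x. x \<in> K \<Longrightarrow> lsc_on K (\<lambda>y. F x y) (K - D)"
    and "\<And>x. x \<in> D \<Longrightarrow> sv_convex_on D (\<lambda>y. F x y)"
    and "\<And>x. x \<in> D \<Longrightarrow> sv_nonneg (F x x)"
  shows "\<exists>x0\<in>K. \<forall>y\<in>K. sv_nonneg (F x0 y)"
proof -
  define G where "G = (\<lambda>y. {x\<in>K. sv_nonneg (F x y)})"
  have closed: "closed (G y)" if "y \<in> D" for y
    unfolding G_def using closed_sv_nonneg assms that by blast
  have cover: "convex hull Z \<subseteq> (\<Union>y\<in>Z. G y)" if "finite Z" "Z \<subseteq> D" for Z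
  proof -
    have "convex hull Z \<inter> D \<subseteq> (\<Union>y\<in>Z. G y)"
    proof
      fix x assume x: "x \<in> convex hull Z \<inter> D"
      \<comment> \<open>The point \<open>x\<close> plays both roles: \<open>F x\<close> is convex on
        \<open>D\<close> by (iii), and its value at \<open>x\<close> is nonnegative by (iv).\<close>
      then have "\<exists>y\<in>Z. sv_nonneg (F x y)"
        using assms that by (intro sv_convex_on_nonneg_hull[of D "F x" Z x]) auto
      then show "x \<in> (\<Union>y\<in>Z. G y)"
        using x \<open>D \<subseteq> K\<close> by (auto simp: G_def)
    qed
    then have "closure (convex hull Z \<inter> D) \<subseteq> (\<Union>y\<in>Z. G y)"
      using that closed by (intro closure_minimal closed_UN) auto
    then show ?thesis
      using self_segment_dense_convex_hull assms that by blast
  qed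
  have "K \<inter> (\<Inter>y\<in>D. G y) \<noteq> {}"
  proof (rule compact_imp_fip_image[OF \<open>compact K\<close> closed])
    fix Y assume Y: "finite Y" "Y \<subseteq> D"
    show "K \<inter> (\<Inter>y\<in>Y. G y) \<noteq> {}"
    proof (cases "Y = {}")
      case True
      then show ?thesis using \<open>K \<noteq> {}\<close> by simp
    next
      case False
      have "\<exists>x\<in>convex hull Y. \<forall>y\<in>Y. x \<in> G y"
        using Y closed by (intro KKM_finite False cover) (auto intro: finite_subset)
      \<comment> \<open>Any single \<open>G y\<close> with \<open>y \<in> Y\<close> places the point
        in \<open>K\<close>.\<close>
      then show ?thesis
        using False by (auto simp: G_def)
    qed
  qed
  then obtain x0 where x0: "x0 \<in> K" "\<And>y. y \<in> D \<Longrightarrow> sv_nonneg (F x0 y)"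
    by (auto simp: G_def)
  have "sv_nonneg (F x0 y)" if y: "y \<in> K - D" for y
  proof (rule ccontr)
    assume "\<not> sv_nonneg (F x0 y)"
    then have "F x0 y \<inter> {..<0} \<noteq> {}"
      by (auto simp: sv_nonneg_def not_le)
    moreover have "lsc_at K (F x0) y"
      using assms(7)[OF x0(1)] y by (simp add: lsc_on_def)
    ultimately obtain M where M: "openin (top_of_set K) M" "y \<in> M"
      "\<forall>w\<in>M \<inter> sv_domain K (F x0). F x0 w \<inter> {..<0} \<noteq> {}"
      unfolding lsc_at_def by (meson open_lessThan)
    obtain U where U: "open U" "M = K \<inter> U"
      using M(1) by (auto simp: openin_open)
    have "y \<in> closure D"
      using assms(5) y by (auto simp: self_segment_dense_def)
    then obtain w where w: "w \<in> D" "w \<in> U"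
      using U M(2) by (meson IntD2 closure_iff_nhds_not_empty disjoint_iff order_refl)
    \<comment> \<open>Semicontinuity in (ii) controls only points with nonempty value; that
      \<open>F x0 w\<close> is nonempty comes from (i) at \<open>w \<in> D\<close>.\<close>
    have "w \<in> sv_domain K (F x0)"
      using assms(6)[OF w(1)] x0(1) w(1) \<open>D \<subseteq> K\<close> by (auto simp: lsc_on_def lsc_at_def sv_domain_def)
    then have "F x0 w \<inter> {..<0} \<noteq> {}"
      using M(3) U w \<open>D \<subseteq> K\<close> by blast
    then show False
      using x0(2)[OF w(1)] by (auto simp: sv_nonneg_def)
  qed
  then show ?thesis
    using x0 by blast
qed

end
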